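(* $ah(3,4)\le 27$, and $ah(3,n)\le 3^{n-1}-2\cdot 3^{n-4}+2$ for all natural numbers $n>4$.
   Context: $[3]^n$ is the set of words $x=(x_1,\dots,x_n)$ with $x_i\in\{1,2,3\}$. A combinatorial line is determined by a word $w\in(\{1,2,3\}\cup\{*\})^n$ containing at least one $*$; it consists of the 3 points $w(1),w(2),w(3)$, where $w(i)$ is obtained from $w$ by replacing every $*$ by $i$. An $r$-coloring of $[3]^n$ is a coloring of all points using exactly $r$ colors. A line is rainbow if its 3 points receive 3 pairwise different colors. $ah(3,n)$ is the least $r$ such that every $r$-coloring of $[3]^n$ contains a rainbow combinatorial line. *)

theory Defs
  imports Main
begin

definition word_cube :: "nat \<Rightarrow> nat \<Rightarrow> nat list set" where
  "word_cube k n = {x. length x = n \<and> set x \<subseteq> {1..k}}"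

(* In template words the symbol * is None and the letter a is Some a. *)
definition template_words :: "nat \<Rightarrow> nat \<Rightarrow> nat option list set" where
  "template_words k n =
     {w. length w = n \<and> set w \<subseteq> insert None (Some ` {1..k}) \<and> None \<in> set w}"

definition fill :: "nat option list \<Rightarrow> nat \<Rightarrow> nat list" where
  "fill w i = map (\<lambda>s. case s of None \<Rightarrow> i | Some a \<Rightarrow> a) w"

definition combinatorial_lines :: "nat \<Rightarrow> nat \<Rightarrow> nat list set set" where
  "combinatorial_lines k n = {fill w ` {1..k} | w. w \<in> template_words k n}"

(* Only the values of c on word_cube k n matter.  The colors are natural numbers, of which
   exactly r are used. *)
definition is_coloring :: "nat \<Rightarrow> nat \<Rightarrow> nat \<Rightarrow> (nat list \<Rightarrow> nat) \<Rightarrow> bool" where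
  "is_coloring k n r c \<longleftrightarrow> card (c ` word_cube k n) = r"

definition rainbow :: "(nat list \<Rightarrow> nat) \<Rightarrow> nat list set \<Rightarrow> bool" where
  "rainbow c L \<longleftrightarrow> inj_on c L"

(* The least r is taken over positive r: there are no 0-colorings of a nonempty cube, so
   r = 0 would satisfy the condition vacuously. *)
definition ah :: "nat \<Rightarrow> nat \<Rightarrow> nat" where
  "ah k n = (LEAST r. r > 0 \<and>
     (\<forall>c. is_coloring k n r c \<longrightarrow> (\<exists>L\<in>combinatorial_lines k n. rainbow c L)))"

end

theory Submission
  imports Defs
begin

text \<open>
  Split the cube into three layers by the first coordinate. In a coloring without rainbow lines
  every line in the first direction repeats a color, so layers share colors; the loss against the
  sum of the numbers of colors of the layers is at least 2 unless some layer has very few colors.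
  Hence the maximal number of colors satisfies f (n + 1) \<le> 3 f n - 2, which gives
  f 1 \<le> 2, f 2 \<le> 4, f 3 \<le> 10, and it remains to improve f 4 \<le> 28 to f 4 \<le> 26.

  If f 3 = 10 is attained, the loss is exactly 2, which forces a dominating color on 18 points
  while the other 9 points have pairwise different colors; these 9 points form a Latin square
  that avoids the main diagonal. For 27 colors in dimension 4, two layers are of this kind and
  have the same dominating color a. The third layer then has non-a colors on the main diagonal,
  two of which coincide, and this is the only coincidence among the colors other than a. The same
  argument with respect to the last coordinate puts the coincidence on a different line.
\<close>

section \<open>Rainbow-free colorings and the split into layers\<close>

text \<open>Indexed by templates rather than by lines as sets, so that fixing the first coordinate
  and reversing words act directly on the template.\<close>

definition rainbow_free :: "nat \<Rightarrow> (nat list \<Rightarrow> nat) \<Rightarrow> bool" where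
  "rainbow_free n c \<longleftrightarrow> (\<forall>w\<in>template_words 3 n.
     c (fill w 1) = c (fill w 2) \<or> c (fill w 1) = c (fill w 3) \<or> c (fill w 2) = c (fill w 3))"

lemma atLeastAtMost_1_3: "{1..3::nat} = {1, 2, 3}"
  by auto

lemma rainbow_freeI:
  assumes "\<not> (\<exists>L\<in>combinatorial_lines 3 n. rainbow c L)"
  shows "rainbow_free n c"
  unfolding rainbow_free_def
proof (rule ballI, rule ccontr)
  fix w assume "w \<in> template_words 3 n"
    and "\<not> (c (fill w 1) = c (fill w 2) \<or> c (fill w 1) = c (fill w 3) \<or> c (fill w 2) = c (fill w 3))"
  then have "rainbow c (fill w ` {1..3})" "fill w ` {1..3} \<in> combinatorial_lines 3 n"
    unfolding rainbow_def atLeastAtMost_1_3 combinatorial_lines_def by auto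
  with assms show False by blast
qed

lemma finite_word_cube [simp]: "finite (word_cube k n)"
  unfolding word_cube_def using finite_lists_length_eq[of "{1..k}" n] by (simp add: conj_commute)

lemma card_word_cube: "card (word_cube k n) = k ^ n"
  unfolding word_cube_def using card_lists_length_eq[of "{1..k}" n] by (simp add: conj_commute)

lemma word_cube_0 [simp]: "word_cube k 0 = {[]}"
  by (auto simp: word_cube_def)

lemma Cons_mem_word_cube [simp]:
  "a # x \<in> word_cube k (Suc n) \<longleftrightarrow> a \<in> {1..k} \<and> x \<in> word_cube k n"
  by (auto simp: word_cube_def)

lemma word_cube_3_Suc:
  "word_cube 3 (Suc n) =
     Cons 1 ` word_cube 3 n \<union> Cons 2 ` word_cube 3 n \<union> Cons 3 ` word_cube 3 n"
proof (intro equalityI subsetI)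
  fix y assume y: "y \<in> word_cube 3 (Suc n)"
  then obtain a x where "y = a # x" by (cases y) (auto simp: word_cube_def)
  with y have "a \<in> {1, 2, 3}" "x \<in> word_cube 3 n"
    unfolding atLeastAtMost_1_3[symmetric] by simp_all
  with \<open>y = a # x\<close> show
    "y \<in> Cons 1 ` word_cube 3 n \<union> Cons 2 ` word_cube 3 n \<union> Cons 3 ` word_cube 3 n" by blast
qed auto

lemma image_word_cube_3_Suc:
  "c ` word_cube 3 (Suc n) = (\<lambda>x. c (1 # x)) ` word_cube 3 n \<union>
     (\<lambda>x. c (2 # x)) ` word_cube 3 n \<union> (\<lambda>x. c (3 # x)) ` word_cube 3 n"
  by (simp add: word_cube_3_Suc image_Un image_image)

lemma card_filter_word_cube_3_Suc:
  "card {p \<in> word_cube 3 (Suc n). P p} = card {x \<in> word_cube 3 n. P (1 # x)} +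
     card {x \<in> word_cube 3 n. P (2 # x)} + card {x \<in> word_cube 3 n. P (3 # x)}"
proof -
  define L where "L a = Cons a ` {x \<in> word_cube 3 n. P (a # x)}" for a
  have card_L: "card (L a) = card {x \<in> word_cube 3 n. P (a # x)}" for a
    unfolding L_def by (rule card_image) simp
  have fin: "finite (L a)" for a
    unfolding L_def by (intro finite_imageI finite_subset[OF _ finite_word_cube]) blast
  have disj: "L a \<inter> L b = {}" if "a \<noteq> b" for a b
    using that unfolding L_def by blast
  have "{p \<in> word_cube 3 (Suc n). P p} = L 1 \<union> L 2 \<union> L 3"
    unfolding word_cube_3_Suc L_def by blast
  also have "card \<dots> = card (L 1) + card (L 2) + card (L 3)"
    using disj[of 1 2] disj[of 1 3] disj[of 2 3]
    by (simp add: fin card_Un_disjoint Int_Un_distrib2)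
  finally show ?thesis unfolding card_L .
qed

lemma rainbow_free_Cons:
  assumes "rainbow_free (Suc n) c" "a \<in> {1..3}"
  shows "rainbow_free n (\<lambda>x. c (a # x))"
  unfolding rainbow_free_def
proof
  fix w assume "w \<in> template_words 3 n"
  then have "Some a # w \<in> template_words 3 (Suc n)"
    using assms(2) by (auto simp: template_words_def)
  with assms(1) show "c (a # fill w 1) = c (a # fill w 2) \<or> c (a # fill w 1) = c (a # fill w 3) \<or>
      c (a # fill w 2) = c (a # fill w 3)"
    unfolding rainbow_free_def by (fastforce simp: fill_def)
qed

lemma rainbow_free_vertical:
  assumes "rainbow_free (Suc n) c" "x \<in> word_cube 3 n"
  shows "c (1 # x) = c (2 # x) \<or> c (1 # x) = c (3 # x) \<or> c (2 # x) = c (3 # x)"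
proof -
  have "None # map Some x \<in> template_words 3 (Suc n)"
    using assms(2) by (auto simp: template_words_def word_cube_def)
  moreover have "fill (None # map Some x) i = i # x" for i
    by (simp add: fill_def comp_def)
  ultimately show ?thesis using assms(1) unfolding rainbow_free_def by metis
qed

text \<open>Reversal permutes the templates. It transfers results about the first coordinate to the
  last one.\<close>

lemma rainbow_free_rev:
  assumes "rainbow_free n c"
  shows "rainbow_free n (c \<circ> rev)"
  unfolding rainbow_free_def
proof
  fix w assume "w \<in> template_words 3 n"
  then have "rev w \<in> template_words 3 n" by (simp add: template_words_def)
  moreover have "fill (rev w) i = rev (fill w i)" for i
    by (simp add: fill_def rev_map)
  ultimately show "(c \<circ> rev) (fill w 1) = (c \<circ> rev) (fill w 2) \<or>
      (c \<circ> rev) (fill w 1) = (c \<circ> rev) (fill w 3) \<or> (c \<circ> rev) (fill w 2) = (c \<circ> rev) (fill w 3)"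
    using assms unfolding rainbow_free_def comp_def by metis
qed

lemma rev_word_cube: "rev ` word_cube k n = word_cube k n"
proof (intro equalityI subsetI)
  fix y assume "y \<in> word_cube k n"
  then have "rev y \<in> word_cube k n" by (simp add: word_cube_def)
  then have "rev (rev y) \<in> rev ` word_cube k n" by (rule imageI)
  then show "y \<in> rev ` word_cube k n" by simp
qed (auto simp: word_cube_def)

section \<open>Colors shared between layers and the recursion\<close>

text \<open>Inclusion-exclusion sorted by multiplicity: an element of exactly two sets is counted
  once in the second term, an element of all three once in the second and once in the third. These
  two terms are the loss against the sum.\<close>

lemma card_three_sets:
  assumes "finite A" "finite B" "finite C"
  shows "card A + card B + card C =
    card (A \<union> B \<union> C) + card (A \<inter> B \<union> A \<inter> C \<union> B \<inter> C) + card (A \<inter> B \<inter> C)"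
proof -
  have "card A + card B = card (A \<union> B) + card (A \<inter> B)"
    by (rule card_Un_Int) (use assms in auto)
  moreover have "card (A \<union> B) + card C = card (A \<union> B \<union> C) + card ((A \<union> B) \<inter> C)"
    by (rule card_Un_Int) (use assms in auto)
  moreover have "card (A \<inter> B) + card ((A \<union> B) \<inter> C) =
      card (A \<inter> B \<union> (A \<union> B) \<inter> C) + card (A \<inter> B \<inter> ((A \<union> B) \<inter> C))"
    by (rule card_Un_Int) (use assms in auto)
  moreover have "A \<inter> B \<union> (A \<union> B) \<inter> C = A \<inter> B \<union> A \<inter> C \<union> B \<inter> C"
    "A \<inter> B \<inter> ((A \<union> B) \<inter> C) = A \<inter> B \<inter> C" by auto
  ultimately show ?thesis by simp
qed

text \<open>If \<open>B\<close> and \<open>C\<close> were disjoint, the coincidence at each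
  \<open>x\<close> would involve \<open>u x\<close>, so all of \<open>A\<close> would lie in
  \<open>S\<close>, which is too small.\<close>

lemma inter_images_nonempty:
  fixes u v w :: "'a \<Rightarrow> 'b"
  assumes eqs: "A = u ` X" "B = v ` X" "C = w ` X"
    and agree: "\<And>x. x \<in> X \<Longrightarrow> u x = v x \<or> u x = w x \<or> v x = w x"
    and S: "finite S" "A \<inter> B \<subseteq> S" "A \<inter> C \<subseteq> S" "card S < card A"
  shows "B \<inter> C \<noteq> {}"
proof
  assume empty: "B \<inter> C = {}"
  have "A \<subseteq> S"
    unfolding eqs(1)
  proof (rule image_subsetI)
    fix x assume x: "x \<in> X"
    then have "u x \<in> A" "v x \<in> B" "w x \<in> C" using eqs by auto
    with agree[OF x] empty S(2,3) show "u x \<in> S" by (metis IntI empty_iff subsetD)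
  qed
  with S(1,4) show False by (meson card_mono not_le)
qed

text \<open>If \<open>T\<close> is empty, the three pairwise intersections are disjoint and
  nonempty, so \<open>card S\<close> is at least 3. Otherwise \<open>T\<close> is a nonempty subset
  of \<open>S\<close>, and the sum is at least 2, with equality only for the same singleton.\<close>

lemma overlap_lower_bound:
  assumes "finite A" "finite B" "finite C"
    and ne: "A \<inter> B \<noteq> {}" "A \<inter> C \<noteq> {}" "B \<inter> C \<noteq> {}"
  defines "S \<equiv> A \<inter> B \<union> A \<inter> C \<union> B \<inter> C" and "T \<equiv> A \<inter> B \<inter> C"
  shows "3 \<le> card S + card T \<or> (S = T \<and> card S = 1)"
proof (cases "T = {}")
  case True
  have "card S = card (A \<inter> B) + card (A \<inter> C) + card (B \<inter> C)"
    unfolding S_def using assms(1-3) True[unfolded T_def]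
    by (subst card_Un_disjoint; (subst card_Un_disjoint)?) auto
  moreover have "0 < card (A \<inter> B)" "0 < card (A \<inter> C)" "0 < card (B \<inter> C)"
    using ne assms(1-3) by (simp_all add: card_gt_0_iff)
  ultimately show ?thesis by linarith
next
  case False
  have fin: "finite S" "T \<subseteq> S" using assms(1-3) by (auto simp: S_def T_def)
  then have "0 < card T" "card T \<le> card S"
    using False by (auto simp: card_gt_0_iff card_mono intro: finite_subset)
  then consider "3 \<le> card S + card T" | "card T = 1" "card S = 1" by linarith
  then show ?thesis
    by cases (use fin card_subset_eq[of S T] in auto)
qed

text \<open>The loss is \<open>card S + card T\<close>. When each layer has more than
  \<open>card S\<close> colors, any two layers share a color, and the lower bound on the overlap
  applies.\<close>

lemma layer_cases:
  fixes c :: "nat list \<Rightarrow> nat" and n :: nat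
  defines "X \<equiv> word_cube 3 n"
  defines "A \<equiv> (\<lambda>x. c (1 # x)) ` X" and "B \<equiv> (\<lambda>x. c (2 # x)) ` X" and "C \<equiv> (\<lambda>x. c (3 # x)) ` X"
  defines "S \<equiv> A \<inter> B \<union> A \<inter> C \<union> B \<inter> C" and "T \<equiv> A \<inter> B \<inter> C"
  assumes rf: "rainbow_free (Suc n) c"
  shows "card A + card B + card C = card (c ` word_cube 3 (Suc n)) + card S + card T"
    and "card A \<le> card S \<or> card B \<le> card S \<or> card C \<le> card S \<or>
      3 \<le> card S + card T \<or> (S = T \<and> card S = 1)"
proof -
  have fin: "finite X" "finite A" "finite B" "finite C" "finite S"
    by (simp_all add: X_def A_def B_def C_def S_def)
  show "card A + card B + card C = card (c ` word_cube 3 (Suc n)) + card S + card T"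
    using card_three_sets[OF fin(2-4)]
    unfolding S_def T_def image_word_cube_3_Suc A_def B_def C_def X_def .
  note ag = rainbow_free_vertical[OF rf, folded X_def]
  show "card A \<le> card S \<or> card B \<le> card S \<or> card C \<le> card S \<or>
      3 \<le> card S + card T \<or> (S = T \<and> card S = 1)"
  proof (cases "card A \<le> card S \<or> card B \<le> card S \<or> card C \<le> card S")
    case False
    have eqs: "A = (\<lambda>x. c (1 # x)) ` X" "B = (\<lambda>x. c (2 # x)) ` X" "C = (\<lambda>x. c (3 # x)) ` X"
      unfolding A_def B_def C_def by (rule refl)+
    have S: "A \<inter> B \<subseteq> S" "A \<inter> C \<subseteq> S" "B \<inter> C \<subseteq> S" "B \<inter> A \<subseteq> S" "C \<inter> A \<subseteq> S" "C \<inter> B \<subseteq> S"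
      unfolding S_def by blast+
    have lt: "card S < card A" "card S < card B" "card S < card C" using False by simp_all
    have "B \<inter> C \<noteq> {}"
      by (rule inter_images_nonempty[OF eqs(1,2,3) _ fin(5) S(1,2) lt(1)]) (use ag in blast)
    moreover have "A \<inter> C \<noteq> {}"
      by (rule inter_images_nonempty[OF eqs(2,1,3) _ fin(5) S(4,3) lt(2)]) (use ag in metis)
    moreover have "A \<inter> B \<noteq> {}"
      by (rule inter_images_nonempty[OF eqs(3,1,2) _ fin(5) S(5,6) lt(3)]) (use ag in metis)
    ultimately show ?thesis
      using overlap_lower_bound[of A B C] fin unfolding S_def T_def by blast
  qed blast
qed

text \<open>Normally the loss is at least 2. A layer with at most \<open>card S\<close> colors is
  absorbed by the loss, which leaves at most \<open>2 * b\<close> colors; this is where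
  \<open>2 <= b\<close> enters.\<close>

lemma card_colors_Suc_le:
  assumes bound: "\<And>c. rainbow_free n c \<Longrightarrow> card (c ` word_cube 3 n) \<le> b"
    and "2 \<le> b" "rainbow_free (Suc n) c"
  shows "card (c ` word_cube 3 (Suc n)) \<le> 3 * b - 2"
proof -
  have "card ((\<lambda>x. c (a # x)) ` word_cube 3 n) \<le> b" if "a \<in> {1..3}" for a
    using bound rainbow_free_Cons[OF assms(3) that] by blast
  then have "card ((\<lambda>x. c (1 # x)) ` word_cube 3 n) \<le> b" "card ((\<lambda>x. c (2 # x)) ` word_cube 3 n) \<le> b"
    "card ((\<lambda>x. c (3 # x)) ` word_cube 3 n) \<le> b" by simp_all
  with layer_cases[OF assms(3)] \<open>2 \<le> b\<close> show ?thesis by (elim disjE) auto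
qed

lemma card_colors_1_le:
  assumes "rainbow_free 1 c"
  shows "card (c ` word_cube 3 1) \<le> 2"
proof -
  have "c [1] = c [2] \<or> c [1] = c [3] \<or> c [2] = c [3]"
    using rainbow_free_vertical[of 0 c "[]"] assms by simp
  then have "card {c [1], c [2], c [3]} \<le> 2"
    by (auto simp: card_insert_if)
  moreover have "c ` word_cube 3 1 = {c [1], c [2], c [3]}"
    unfolding One_nat_def image_word_cube_3_Suc by auto
  ultimately show ?thesis by simp
qed

lemma card_colors_2_le: "rainbow_free 2 c \<Longrightarrow> card (c ` word_cube 3 2) \<le> 4"
  using card_colors_Suc_le[of 1 2 c] card_colors_1_le by (simp add: numeral_2_eq_2)

lemma card_colors_3_le: "rainbow_free 3 c \<Longrightarrow> card (c ` word_cube 3 3) \<le> 10"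
  using card_colors_Suc_le[of 2 4 c] card_colors_2_le by (simp add: numeral_3_eq_3)

section \<open>Extremal colorings in dimension 3\<close>

text \<open>The shape of a 10-coloring without rainbow lines: 18 of the 27 points have color
  \<open>a\<close>. The other 9 are called exceptional below.\<close>

definition dominates :: "nat \<Rightarrow> (nat list \<Rightarrow> nat) \<Rightarrow> bool" where
  "dominates a c \<longleftrightarrow> card {x \<in> word_cube 3 3. c x \<noteq> a} = 9 \<and> inj_on c {x \<in> word_cube 3 3. c x \<noteq> a}"

lemma card_image_le_Suc_card_filter:
  assumes "finite X"
  shows "card (c ` X) \<le> Suc (card (c ` {x \<in> X. c x \<noteq> a}))"
proof -
  have "c ` X \<subseteq> insert a (c ` {x \<in> X. c x \<noteq> a})" by auto
  then have "card (c ` X) \<le> card (insert a (c ` {x \<in> X. c x \<noteq> a}))"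
    using assms by (intro card_mono) auto
  also have "\<dots> \<le> Suc (card (c ` {x \<in> X. c x \<noteq> a}))"
    using assms by (simp add: card_insert_if)
  finally show ?thesis .
qed

text \<open>The color repeated over \<open>x\<close> lies in two of the images, so it must be the
  only shared color \<open>a\<close>.\<close>

lemma two_of_three_eqD:
  assumes "u ` X \<inter> v ` X \<union> u ` X \<inter> w ` X \<union> v ` X \<inter> w ` X = {a}" "x \<in> X"
    and "u x = v x \<or> u x = w x \<or> v x = w x"
  shows "(u x = a \<and> v x = a) \<or> (u x = a \<and> w x = a) \<or> (v x = a \<and> w x = a)"
proof -
  have "u x \<in> u ` X" "v x \<in> v ` X" "w x \<in> w ` X" using assms(2) by auto
  with assms(1,3) show ?thesis by (metis IntI UnI1 UnI2 singletonD)
qed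

lemma card_three_filter_le:
  assumes "finite X"
    and two: "\<And>x. x \<in> X \<Longrightarrow> (u x = a \<and> v x = a) \<or> (u x = a \<and> w x = a) \<or> (v x = a \<and> w x = a)"
  shows "card {x \<in> X. u x \<noteq> a} + card {x \<in> X. v x \<noteq> a} + card {x \<in> X. w x \<noteq> a} \<le> card X"
proof -
  have "card {x \<in> X. u x \<noteq> a} + card {x \<in> X. v x \<noteq> a} + card {x \<in> X. w x \<noteq> a} =
      card ({x \<in> X. u x \<noteq> a} \<union> {x \<in> X. v x \<noteq> a} \<union> {x \<in> X. w x \<noteq> a})"
    using assms by (subst card_Un_disjoint; (subst card_Un_disjoint)?) auto
  also have "\<dots> \<le> card X" using assms(1) by (intro card_mono) auto
  finally show ?thesis .
qed

text \<open>Three layers with at most 4 colors each leave a loss of at most 2, so a single color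
  \<open>a\<close> is shared. Each of the 9 lines in the first direction has \<open>a\<close> at
  least twice, hence at most 9 points are exceptional, and they have to carry 9 further
  colors.\<close>

lemma exists_dominates:
  assumes rf: "rainbow_free 3 c" and "10 \<le> card (c ` word_cube 3 3)"
  shows "\<exists>a. dominates a c"
proof -
  define X where "X = word_cube 3 2"
  have rf': "rainbow_free (Suc 2) c" and Q3: "word_cube 3 3 = word_cube 3 (Suc 2)"
    using rf by (simp_all add: numeral_3_eq_3)
  have "card ((\<lambda>x. c (a # x)) ` word_cube 3 2) \<le> 4" if "a \<in> {1..3}" for a
    using card_colors_2_le rainbow_free_Cons[OF rf' that] by blast
  then have "card ((\<lambda>x. c (1 # x)) ` X) \<le> 4" "card ((\<lambda>x. c (2 # x)) ` X) \<le> 4"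
    "card ((\<lambda>x. c (3 # x)) ` X) \<le> 4" by (simp_all add: X_def)
  moreover note lc = layer_cases[OF rf', folded X_def]
  ultimately have "card ((\<lambda>x. c (1 # x)) ` X \<inter> (\<lambda>x. c (2 # x)) ` X \<union>
      (\<lambda>x. c (1 # x)) ` X \<inter> (\<lambda>x. c (3 # x)) ` X \<union> (\<lambda>x. c (2 # x)) ` X \<inter> (\<lambda>x. c (3 # x)) ` X) = 1"
    using assms(2)[unfolded Q3] by (elim disjE conjE) linarith+
  then obtain a where a: "(\<lambda>x. c (1 # x)) ` X \<inter> (\<lambda>x. c (2 # x)) ` X \<union>
      (\<lambda>x. c (1 # x)) ` X \<inter> (\<lambda>x. c (3 # x)) ` X \<union> (\<lambda>x. c (2 # x)) ` X \<inter> (\<lambda>x. c (3 # x)) ` X = {a}"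
    by (rule card_1_singletonE)
  let ?N = "{p \<in> word_cube 3 3. c p \<noteq> a}"
  have "card ?N \<le> card X"
    unfolding Q3 card_filter_word_cube_3_Suc X_def[symmetric]
    by (rule card_three_filter_le)
      (use two_of_three_eqD[OF a] rainbow_free_vertical[OF rf'] in \<open>auto simp: X_def\<close>)
  then have "card ?N \<le> 9" by (simp add: X_def card_word_cube)
  moreover have "9 \<le> card (c ` ?N)"
    using card_image_le_Suc_card_filter[of "word_cube 3 3" c a] assms(2) by simp
  moreover have "card (c ` ?N) \<le> card ?N" by (rule card_image_le) simp
  ultimately have "card ?N = 9" "card (c ` ?N) = card ?N" by linarith+
  then show ?thesis
    unfolding dominates_def by (auto intro!: exI[of _ a] eq_card_imp_inj_on)
qed

lemma fill_eq_iff: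
  assumes "None \<in> set w"
  shows "fill w i = fill w j \<longleftrightarrow> i = j"
  using assms unfolding fill_def by (auto split: option.splits)

lemma fill_mem_word_cube:
  assumes "w \<in> template_words k n" "i \<in> {1..k}"
  shows "fill w i \<in> word_cube k n"
  using assms unfolding fill_def template_words_def word_cube_def
  by (auto split: option.splits)

text \<open>By injectivity away from \<open>a\<close>, only \<open>a\<close> can be repeated on the
  line. It occupies two of the three points, which leaves room for one exceptional point.\<close>

lemma dominates_line:
  assumes rf: "rainbow_free 3 c" and dom: "dominates a c" and w: "w \<in> template_words 3 3"
    and ij: "i \<in> {1..3}" "j \<in> {1..3}" "i \<noteq> j"
  shows "c (fill w i) = a \<or> c (fill w j) = a"
proof (rule ccontr)
  assume *: "\<not> ?thesis"
  have N: "None \<in> set w" using w by (simp add: template_words_def)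
  have inj: "x = y" if "c (fill w x) = c (fill w y)" "c (fill w x) \<noteq> a" "x \<in> {1..3}" "y \<in> {1..3}" for x y
  proof -
    have "fill w x = fill w y"
      using dom that fill_mem_word_cube[OF w] unfolding dominates_def
      by (intro inj_onD[of c "{x \<in> word_cube 3 3. c x \<noteq> a}"]) auto
    then show ?thesis using fill_eq_iff[OF N] by blast
  qed
  obtain x y where xy: "x \<in> {1..3}" "y \<in> {1..3}" "x \<noteq> y" "c (fill w x) = c (fill w y)"
  proof -
    have "(1::nat) \<in> {1..3}" "(2::nat) \<in> {1..3}" "(3::nat) \<in> {1..3}"
      "(1::nat) \<noteq> 2" "(1::nat) \<noteq> 3" "(2::nat) \<noteq> 3" by simp_all
    then show thesis using rf w that unfolding rainbow_free_def by metis
  qed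
  then have "c (fill w x) = a" using inj by blast
  then have "x \<noteq> i" "x \<noteq> j" "y \<noteq> i" "y \<noteq> j" using * xy(4) by auto
  moreover have "x = 1 \<or> x = 2 \<or> x = 3" "y = 1 \<or> y = 2 \<or> y = 3" "i = 1 \<or> i = 2 \<or> i = 3"
    "j = 1 \<or> j = 2 \<or> j = 3" using xy(1,2) ij(1,2) unfolding atLeastAtMost_1_3 by blast+
  ultimately show False using xy(3) ij(3) by metis
qed

lemma other_two_indices:
  assumes "i \<in> {1..3::nat}"
  obtains j k where "{1..3} = {i, j, k}" "j \<noteq> i" "k \<noteq> i" "j \<noteq> k"
proof -
  have sets: "{1..3::nat} = {1, 2, 3}" "{1..3::nat} = {2, 1, 3}" "{1..3::nat} = {3, 1, 2}" by auto
  from assms consider "i = 1" | "i = 2" | "i = 3" unfolding sets(1) by blast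
  then show thesis
    by cases (use that[of 2 3] that[of 1 3] that[of 1 2] sets in simp_all)
qed

text \<open>Each line in the first direction contains an exceptional point, and no line contains
  two. Starting from an exceptional \<open>[i, i, i]\<close>, this forces first
  \<open>[k, i, j]\<close> and then \<open>[j, j, j]\<close> to be exceptional, which puts two
  exceptional points on the main diagonal.\<close>

lemma dominates_diagonal:
  assumes rf: "rainbow_free 3 c" and dom: "dominates a c" and i: "i \<in> {1..3}"
  shows "c [i, i, i] = a"
proof (rule ccontr)
  assume iii: "c [i, i, i] \<noteq> a"
  let ?N = "{p \<in> word_cube 3 3. c p \<noteq> a}"
  note line = dominates_line[OF rf dom]
  obtain j k where jk: "{1..3} = {i, j, k}" "j \<noteq> i" "k \<noteq> i" "j \<noteq> k"
    using other_two_indices[OF i] by blast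
  then have jk3: "j \<in> {1..3}" "k \<in> {1..3}" by blast+
  have hit: "c (i # y) \<noteq> a \<or> c (j # y) \<noteq> a \<or> c (k # y) \<noteq> a" if y: "y \<in> word_cube 3 2" for y
  proof -
    \<comment> \<open>Exceptional points with the same tail lie on one line, so they are equal.
      Since there are 9 exceptional points and 9 tails, every tail occurs.\<close>
    have "inj_on tl ?N"
    proof (rule inj_onI)
      fix p q assume pq: "p \<in> ?N" "q \<in> ?N" "tl p = tl q"
      obtain x y x' where eq: "p = x # y" "q = x' # y" 
        using pq by (cases p; cases q) (auto simp: word_cube_def)
      have mem: "x \<in> {1..3}" "x' \<in> {1..3}" "y \<in> word_cube 3 2"
        using pq eq by (auto simp: numeral_3_eq_3 numeral_2_eq_2)
      have "None # map Some y \<in> template_words 3 3"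
        using mem by (auto simp: template_words_def word_cube_def)
      from line[OF this, of x x'] pq eq mem show "p = q"
        by (auto simp: fill_def comp_def)
    qed
    then have card_tl: "card (tl ` ?N) = card (word_cube 3 2)"
      using dom by (simp add: card_image dominates_def card_word_cube)
    have "tl ` ?N \<subseteq> word_cube 3 2"
    proof (rule image_subsetI)
      fix p assume "p \<in> ?N"
      then show "tl p \<in> word_cube 3 2" by (cases p) (auto simp: word_cube_def)
    qed
    then have "tl ` ?N = word_cube 3 2" using card_tl by (rule card_subset_eq[OF finite_word_cube])
    with y have "y \<in> tl ` ?N" by (simp only:)
    then obtain p where p: "y = tl p" "p \<in> ?N" by (rule imageE)
    have "length p = Suc 2" using p(2) by (simp add: word_cube_def)
    then obtain x where "p = x # y" unfolding p(1) by (cases p) simp_all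
    with p(2) have "x \<in> {1..3}" "c (x # y) \<noteq> a" by (simp_all add: numeral_3_eq_3)
    then show ?thesis unfolding jk(1) by blast
  qed
  have "c [i, i, j] = a"
    using line[of "[Some i, Some i, None]" i j] i jk3 jk(2-4) iii by (auto simp: template_words_def fill_def)
  moreover have "c [j, i, j] = a"
    using line[of "[None, Some i, None]" i j] i jk3 jk(2-4) iii by (auto simp: template_words_def fill_def)
  moreover have "[i, j] \<in> word_cube 3 2" using i jk3 by (auto simp: word_cube_def)
  ultimately have kij: "c [k, i, j] \<noteq> a" using hit by blast
  have "c [i, j, j] = a"
    using line[of "[Some i, None, None]" i j] i jk3 jk(2-4) iii by (auto simp: template_words_def fill_def)
  moreover have "c [k, j, j] = a"
    using line[of "[Some k, None, Some j]" i j] i jk3 jk(2-4) kij by (auto simp: template_words_def fill_def)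
  moreover have "[j, j] \<in> word_cube 3 2" using jk3 by (auto simp: word_cube_def)
  ultimately have "c [j, j, j] \<noteq> a" using hit by blast
  then show False
    using line[of "[None, None, None]" i j] i jk3 jk(2-4) iii by (auto simp: template_words_def fill_def)
qed

section \<open>Dimension 4: at most 26 colors\<close>

text \<open>Where the agreeing color is not dominating in both layers, it determines the position,
  so such positions inject into the shared colors. All other agreements require \<open>a = b\<close>
  and lie among the 18 points of color \<open>a\<close>.\<close>

lemma card_agree_le:
  assumes "dominates a u" "dominates b v"
  shows "card {x \<in> word_cube 3 3. u x = v x} \<le>
    (if a = b then 18 else 0) + card (u ` word_cube 3 3 \<inter> v ` word_cube 3 3)"
proof -
  let ?X = "word_cube 3 3"
  let ?I = "u ` ?X \<inter> v ` ?X"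
  have inju: "inj_on u {x \<in> ?X. u x \<noteq> a}" and injv: "inj_on v {x \<in> ?X. v x \<noteq> b}"
    using assms by (simp_all add: dominates_def)
  define P where "P = {x \<in> ?X. u x = v x \<and> (u x \<noteq> a \<or> v x \<noteq> b)}"
  have "inj_on u P"
  proof (rule inj_onI)
    fix x y assume "x \<in> P" "y \<in> P" "u x = u y"
    then show "x = y"
      using inj_onD[OF inju, of x y] inj_onD[OF injv, of x y] by (auto simp: P_def)
  qed
  moreover have "u ` P \<subseteq> ?I"
  proof (rule image_subsetI)
    fix x assume "x \<in> P"
    then have "x \<in> ?X" "u x = v x" by (simp_all add: P_def)
    then show "u x \<in> ?I" by (metis IntI imageI)
  qed
  ultimately have P: "card P \<le> card ?I" by (intro card_inj_on_le) auto
  show ?thesis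
  proof (cases "a = b")
    case True
    have "card {x \<in> ?X. u x = a} = card (?X - {x \<in> ?X. u x \<noteq> a})"
      by (rule arg_cong[of _ _ card]) auto
    also have "\<dots> = 18"
      using assms(1) by (subst card_Diff_subset) (auto simp: dominates_def card_word_cube)
    finally have "card {x \<in> ?X. u x = a} = 18" .
    moreover have "card {x \<in> ?X. u x = v x} \<le> card ({x \<in> ?X. u x = a} \<union> P)"
      by (intro card_mono) (auto simp: P_def)
    moreover have "\<dots> \<le> card {x \<in> ?X. u x = a} + card P" by (rule card_Un_le)
    ultimately show ?thesis using P True by simp
  next
    case False
    then have "{x \<in> ?X. u x = v x} = P" by (auto simp: P_def)
    with P False show ?thesis by simp
  qed
qed

text \<open>Agreeing positions are rare for layers with different dominating colors, so all three coincide.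
  Then the three sets of 9 exceptional positions avoid D, and hence overlap too much.\<close>

lemma three_dominated_layers_false:
  fixes u v w :: "nat list \<Rightarrow> nat"
  defines "X \<equiv> word_cube 3 3"
  defines "S \<equiv> u ` X \<inter> v ` X \<union> u ` X \<inter> w ` X \<union> v ` X \<inter> w ` X" and "T \<equiv> u ` X \<inter> v ` X \<inter> w ` X"
  assumes dom: "dominates a u" "dominates b v" "dominates d w"
    and agree: "\<And>x. x \<in> X \<Longrightarrow> u x = v x \<or> u x = w x \<or> v x = w x"
    and overlap: "card S + card T \<le> 3"
    and D: "D \<subseteq> X" "card D = 3" "\<And>x. x \<in> D \<Longrightarrow> u x = a \<and> v x = b \<and> w x = d"
  shows False
proof -
  have fin: "finite X" "finite S" "finite T" by (auto simp: X_def S_def T_def)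
  have cX: "card X = 27" by (simp add: X_def card_word_cube)
  have TS: "T \<subseteq> S" by (auto simp: S_def T_def)
  \<comment> \<open>Inclusion-exclusion for the pairwise intersections: all their overlaps equal
    \<open>T\<close>. As \<open>T\<close> has at most one element, the sum is at most 3 + 1.\<close>
  have "card (u ` X \<inter> v ` X) + card (u ` X \<inter> w ` X) + card (v ` X \<inter> w ` X) = card S + card T + card T"
  proof -
    have "u ` X \<inter> v ` X \<inter> (u ` X \<inter> w ` X) \<union> u ` X \<inter> v ` X \<inter> (v ` X \<inter> w ` X) \<union>
        u ` X \<inter> w ` X \<inter> (v ` X \<inter> w ` X) = T"
      "u ` X \<inter> v ` X \<inter> (u ` X \<inter> w ` X) \<inter> (v ` X \<inter> w ` X) = T" by (auto simp: T_def)
    then show ?thesis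
      using card_three_sets[of "u ` X \<inter> v ` X" "u ` X \<inter> w ` X" "v ` X \<inter> w ` X"] fin
      by (simp add: S_def)
  qed
  moreover have "card T \<le> card S" using TS fin by (simp add: card_mono)
  ultimately have sumI: "card (u ` X \<inter> v ` X) + card (u ` X \<inter> w ` X) + card (v ` X \<inter> w ` X) \<le> 4"
    using overlap by linarith
  have "27 \<le> card ({x \<in> X. u x = v x} \<union> {x \<in> X. u x = w x} \<union> {x \<in> X. v x = w x})"
    unfolding cX[symmetric] using agree fin by (intro card_mono) auto
  also have "\<dots> \<le> card {x \<in> X. u x = v x} + card {x \<in> X. u x = w x} + card {x \<in> X. v x = w x}"
    by (meson add_le_mono card_Un_le le_refl order_trans)
  finally have "27 \<le> (if a = b then 18 else 0) + (if a = d then 18 else 0) + (if b = d then 18 else (0::nat)) + 4"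
    using card_agree_le[OF dom(1,2)] card_agree_le[OF dom(1,3)] card_agree_le[OF dom(2,3)] sumI
    unfolding X_def by linarith
  \<comment> \<open>A single equal pair would account for at most 18 + 4 < 27 positions.\<close>
  then have eq: "b = a" "d = a" by (auto split: if_splits)
  obtain z where z: "z \<in> D" using D(2) by fastforce
  then have "u z \<in> u ` X" "v z \<in> v ` X" "w z \<in> w ` X" using D(1) by blast+
  then have aT: "a \<in> T" using D(3)[OF z] eq unfolding T_def by simp
  then have "1 \<le> card T" using fin by (simp add: Suc_le_eq card_gt_0_iff) blast
  then have "card (S - {a}) \<le> 1" using overlap aT TS fin by (subst card_Diff_singleton) auto
  then have uniq: "s = t" if "s \<in> S" "t \<in> S" "s \<noteq> a" "t \<noteq> a" for s t
    using that fin by (auto simp: card_le_Suc0_iff_eq)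
  let ?U = "{x \<in> X. u x \<noteq> a}" and ?V = "{x \<in> X. v x \<noteq> a}" and ?W = "{x \<in> X. w x \<noteq> a}"
  let ?SN = "?U \<inter> ?V \<union> ?U \<inter> ?W \<union> ?V \<inter> ?W"
  have inj: "inj_on u ?U" "inj_on v ?V" "inj_on w ?W"
    and c9: "card ?U = 9" "card ?V = 9" "card ?W = 9"
    using dom eq by (auto simp: dominates_def X_def)
  \<comment> \<open>A position exceptional in two layers shows a shared color other than
    \<open>a\<close>, of which there is only one. Two such positions show it in a common layer,
    since any two pairs of layers meet, and injectivity there identifies them.\<close>
  have "x = y" if xy: "x \<in> ?SN" "y \<in> ?SN" for x y
  proof -
    have pair: "\<exists>s\<in>S. s \<noteq> a \<and> (u t = s \<and> v t = s \<or> u t = s \<and> w t = s \<or> v t = s \<and> w t = s)"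
      if "t \<in> ?SN" for t
    proof -
      have t: "t \<in> X" using that by auto
      then have "u t \<in> u ` X" "v t \<in> v ` X" "w t \<in> w ` X" by auto
      then show ?thesis using agree[OF t] that unfolding S_def by auto
    qed
    obtain s where s: "s \<noteq> a" "s \<in> S"
      "u x = s \<and> v x = s \<or> u x = s \<and> w x = s \<or> v x = s \<and> w x = s"
      using pair[OF xy(1)] by blast
    obtain s' where s': "s' \<noteq> a" "s' \<in> S"
      "u y = s' \<and> v y = s' \<or> u y = s' \<and> w y = s' \<or> v y = s' \<and> w y = s'"
      using pair[OF xy(2)] by blast
    have "s' = s" using uniq s s' by blast
    have X: "x \<in> X" "y \<in> X" using xy by auto
    have "u x = s \<Longrightarrow> u y = s \<Longrightarrow> x = y" "v x = s \<Longrightarrow> v y = s \<Longrightarrow> x = y"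
      "w x = s \<Longrightarrow> w y = s \<Longrightarrow> x = y"
      using inj_onD[OF inj(1), of x y] inj_onD[OF inj(2), of x y] inj_onD[OF inj(3), of x y] X s(1)
      by simp_all
    with s(3) s'(3) \<open>s' = s\<close> show ?thesis by metis
  qed
  then have SN: "card ?SN \<le> 1" using fin by (auto simp: card_le_Suc0_iff_eq)
  have "card (?U \<inter> ?V \<inter> ?W) \<le> card ?SN" using fin by (intro card_mono) auto
  moreover have "card (?U \<union> ?V \<union> ?W) \<le> card (X - D)"
    using D eq fin by (intro card_mono) auto
  moreover have "card (X - D) = 24"
    using D fin cX by (subst card_Diff_subset) (auto intro: finite_subset)
  \<comment> \<open>The 27 exceptional points would have to fit into 24 + 1 + 1.\<close>
  ultimately show False
    using card_three_sets[of ?U ?V ?W] fin c9 SN by simp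
qed

text \<open>A color other than the dominating one occurs at most once, while \<open>s\<close> occurs
  at least twice.\<close>

lemma dominates_eqI:
  assumes "dominates a u" "card {x \<in> word_cube 3 3. u x \<noteq> s} \<le> 25"
  shows "a = s"
proof (rule ccontr)
  let ?X = "word_cube 3 3"
  assume "a \<noteq> s"
  have "inj_on u {x \<in> ?X. u x \<noteq> a}" using assms(1) by (simp add: dominates_def)
  then have "inj_on u {x \<in> ?X. u x = s}" by (rule inj_on_subset) (use \<open>a \<noteq> s\<close> in blast)
  moreover have "u ` {x \<in> ?X. u x = s} \<subseteq> {s}" by auto
  ultimately have "card {x \<in> ?X. u x = s} \<le> card {s}" by (rule card_inj_on_le) simp
  moreover have "card ({x \<in> ?X. u x = s} \<union> {x \<in> ?X. u x \<noteq> s}) \<le>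
      card {x \<in> ?X. u x = s} + card {x \<in> ?X. u x \<noteq> s}" by (rule card_Un_le)
  moreover have "{x \<in> ?X. u x = s} \<union> {x \<in> ?X. u x \<noteq> s} = ?X" by auto
  ultimately show False using assms(2) by (simp add: card_word_cube)
qed

text \<open>The exceptional sets of \<open>u\<close> and \<open>v\<close> are disjoint and leave 9
  positions \<open>?R\<close>, which contain \<open>D\<close> and all non-\<open>s\<close> positions
  of \<open>w\<close>. If \<open>w\<close> avoids \<open>s\<close> on all of \<open>?R\<close>, both
  claims follow. Otherwise it has 8 non-\<open>s\<close> positions with different colors and the
  color \<open>s\<close> just once in \<open>?R\<close>, which excludes
  \<open>w x = w y\<close>.\<close>

lemma third_layer_repetition:
  fixes u v w :: "nat list \<Rightarrow> nat"
  defines "X \<equiv> word_cube 3 3"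
  assumes dom: "dominates a u" "dominates b v" and "9 \<le> card (w ` X)"
    and two: "\<And>x. x \<in> X \<Longrightarrow> (u x = s \<and> v x = s) \<or> (u x = s \<and> w x = s) \<or> (v x = s \<and> w x = s)"
    and D: "D \<subseteq> X" "\<And>x. x \<in> D \<Longrightarrow> u x = a \<and> v x = b"
    and xy: "x \<in> D" "y \<in> D" "x \<noteq> y" "w x = w y"
  shows "w x \<noteq> s \<and>
    card {x \<in> X. u x \<noteq> s} + card {x \<in> X. v x \<noteq> s} + card {x \<in> X. w x \<noteq> s} = 27"
proof -
  let ?U = "{x \<in> X. u x \<noteq> s}" and ?V = "{x \<in> X. v x \<noteq> s}" and ?W = "{x \<in> X. w x \<noteq> s}"
  have fin: "finite X" and cX: "card X = 27" by (simp_all add: X_def card_word_cube)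
  have le: "card ?U + card ?V + card ?W \<le> 27"
    using card_three_filter_le[of X u s v w] fin two cX by simp
  have imW: "8 \<le> card (w ` ?W)"
    using card_image_le_Suc_card_filter[of X w s] assms(4) fin by simp
  then have W: "8 \<le> card ?W" using card_image_le[of ?W w] fin by simp
  have a: "a = s" by (rule dominates_eqI[OF dom(1)]) (use le W in \<open>simp add: X_def\<close>)
  have b: "b = s" by (rule dominates_eqI[OF dom(2)]) (use le W in \<open>simp add: X_def\<close>)
  have c9: "card ?U = 9" "card ?V = 9" using dom a b by (simp_all add: dominates_def X_def)
  let ?R = "X - (?U \<union> ?V)"
  have "card (?U \<union> ?V) = 18"
    using c9 two fin by (subst card_Un_disjoint) auto
  then have R: "card ?R = 9" using cX fin by (subst card_Diff_subset) auto
  have WR: "?W \<subseteq> ?R" using two by blast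
  have DR: "D \<subseteq> ?R" using D a b by auto
  show ?thesis
  proof (cases "?W = ?R")
    case True
    then have "x \<in> ?W" "card ?W = 9" using DR xy(1) R by auto
    then show ?thesis using c9 by simp
  next
    case False
    then have "card ?W < 9" using WR R fin psubset_card_mono[of ?R ?W] by auto
    then have "card ?W = 8" using W by linarith
    then have inj: "inj_on w ?W"
      using imW fin card_image_le[of ?W w] by (intro eq_card_imp_inj_on) auto
    have "w x = s"
    proof (rule ccontr)
      assume "w x \<noteq> s"
      then have "x \<in> ?W" "y \<in> ?W" using xy D(1) by auto
      with inj xy show False by (meson inj_onD)
    qed
    then have "w x = s" "w y = s" using xy(4) by simp_all
    then have "{x, y} \<subseteq> ?R - ?W" using DR xy by auto
    then have "card {x, y} \<le> card (?R - ?W)" using fin by (intro card_mono) auto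
    also have "\<dots> = 1" using R \<open>card ?W = 8\<close> WR fin by (subst card_Diff_subset) auto
    finally show ?thesis using xy(3) by simp
  qed
qed

text \<open>The loss is at most 3. Three layers with 10 colors are impossible, so the loss is 2, a
  single color \<open>s\<close> is shared, and the layers have 10, 10 and 9 colors. In the layer
  with 9 colors the main diagonal has a repetition, necessarily in a color other than
  \<open>s\<close>.\<close>

lemma word_cube_4_repetition:
  assumes rf: "rainbow_free 4 c" and r: "27 \<le> card (c ` word_cube 3 4)"
  shows "\<exists>a. card {p \<in> word_cube 3 4. c p \<noteq> a} = 27 \<and>
    (\<exists>k i j. k \<in> {1..3} \<and> i \<in> {1..3} \<and> j \<in> {1..3} \<and> i \<noteq> j \<and>
      c [k, i, i, i] = c [k, j, j, j] \<and> c [k, i, i, i] \<noteq> a)"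
proof -
  define X where "X = word_cube 3 3"
  define D where "D = {[1,1,1], [2,2,2], [3,3,3::nat]}"
  let ?u = "\<lambda>k x. c (k # x)"
  have rf': "rainbow_free (Suc 3) c" and Q4: "word_cube 3 4 = word_cube 3 (Suc 3)"
    using rf by (simp_all add: eval_nat_numeral)
  have D: "D \<subseteq> X" "card D = 3" by (auto simp: D_def X_def word_cube_def)
  have rfu: "rainbow_free 3 (?u k)" if "k \<in> {1..3}" for k
    using rainbow_free_Cons[OF rf' that] .
  have le10: "card (?u k ` X) \<le> 10" if "k \<in> {1..3}" for k
    using card_colors_3_le[OF rfu[OF that]] by (simp add: X_def)
  have le: "card (?u 1 ` X) \<le> 10" "card (?u 2 ` X) \<le> 10" "card (?u 3 ` X) \<le> 10"
    using le10 by simp_all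
  have ten: "\<exists>a. dominates a (?u k) \<and> (\<forall>x\<in>D. c (k # x) = a)"
    if k: "k \<in> {1..3}" and "10 \<le> card (?u k ` X)" for k
  proof -
    obtain a where a: "dominates a (?u k)"
      using exists_dominates[OF rfu[OF k]] \<open>10 \<le> card (?u k ` X)\<close> by (auto simp: X_def)
    from dominates_diagonal[OF rfu[OF k] a] a show ?thesis by (auto simp: D_def)
  qed
  note agree = rainbow_free_vertical[OF rf', folded X_def]
  let ?A = "?u 1 ` X" and ?B = "?u 2 ` X" and ?C = "?u 3 ` X"
  let ?S = "?A \<inter> ?B \<union> ?A \<inter> ?C \<union> ?B \<inter> ?C" and ?T = "?A \<inter> ?B \<inter> ?C"
  note lc = layer_cases[OF rf', folded X_def, folded Q4]
  have not_all: "\<not> (card ?A = 10 \<and> card ?B = 10 \<and> card ?C = 10)"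
  proof
    assume all: "card ?A = 10 \<and> card ?B = 10 \<and> card ?C = 10"
    obtain a where a: "dominates a (?u 1)" "\<forall>x\<in>D. c (1 # x) = a" using ten[of 1] all by auto
    obtain b where b: "dominates b (?u 2)" "\<forall>x\<in>D. c (2 # x) = b" using ten[of 2] all by auto
    obtain d where d: "dominates d (?u 3)" "\<forall>x\<in>D. c (3 # x) = d" using ten[of 3] all by auto
    show False
      by (rule three_dominated_layers_false[OF a(1) b(1) d(1), of D])
        (use agree lc(1) all r D a b d in \<open>auto simp: X_def\<close>)
  qed
  \<comment> \<open>A layer with at most \<open>card ?S\<close> colors would leave at most 20 colors
    in total, and a loss of 3 would require 10 colors in every layer.\<close>
  have "\<not> (card ?A \<le> card ?S \<or> card ?B \<le> card ?S \<or> card ?C \<le> card ?S \<or> 3 \<le> card ?S + card ?T)"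
    using not_all lc(1) le r by linarith
  with lc(2) have ST: "?S = ?T" "card ?S = 1" by blast+
  then have "card ?T = 1" by simp
  with not_all lc(1) le r ST(2) have sum: "card ?A + card ?B + card ?C = 29" by linarith
  obtain s where s: "?S = {s}" using ST(2) by (rule card_1_singletonE)
  have two: "c (1 # x) = s \<and> c (2 # x) = s \<or> c (1 # x) = s \<and> c (3 # x) = s \<or>
      c (2 # x) = s \<and> c (3 # x) = s" if "x \<in> X" for x
    using two_of_three_eqD[OF s that agree[OF that]] .
  have rep: "\<exists>x\<in>D. \<exists>y\<in>D. x \<noteq> y \<and> c (k # x) = c (k # y)" if "k \<in> {1..3}" for k
  proof -
    have "[None, None, None] \<in> template_words 3 3" by (simp add: template_words_def)
    then have "c [k, 1, 1, 1] = c [k, 2, 2, 2] \<or> c [k, 1, 1, 1] = c [k, 3, 3, 3] \<or>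
        c [k, 2, 2, 2] = c [k, 3, 3, 3]"
      using rfu[OF that] unfolding rainbow_free_def by (auto simp: fill_def)
    then show ?thesis by (auto simp: D_def)
  qed
  have main: "\<exists>x\<in>D. \<exists>y\<in>D. x \<noteq> y \<and> c (k # x) = c (k # y) \<and> c (k # x) \<noteq> s \<and>
      card {x \<in> X. c (i # x) \<noteq> s} + card {x \<in> X. c (j # x) \<noteq> s} + card {x \<in> X. c (k # x) \<noteq> s} = 27"
    if ijk: "i \<in> {1..3}" "j \<in> {1..3}" "k \<in> {1..3}"
      and ij10: "card (?u i ` X) = 10" "card (?u j ` X) = 10" "9 \<le> card (?u k ` X)"
      and two': "\<And>x. x \<in> X \<Longrightarrow> c (i # x) = s \<and> c (j # x) = s \<or> c (i # x) = s \<and> c (k # x) = s \<or>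
        c (j # x) = s \<and> c (k # x) = s" for i j k
  proof -
    obtain a where a: "dominates a (?u i)" "\<forall>x\<in>D. c (i # x) = a" using ten[of i] ijk ij10 by auto
    obtain b where b: "dominates b (?u j)" "\<forall>x\<in>D. c (j # x) = b" using ten[of j] ijk ij10 by auto
    obtain x y where xy: "x \<in> D" "y \<in> D" "x \<noteq> y" "c (k # x) = c (k # y)" using rep ijk by blast
    have "c (k # x) \<noteq> s \<and> card {x \<in> X. c (i # x) \<noteq> s} + card {x \<in> X. c (j # x) \<noteq> s} +
        card {x \<in> X. c (k # x) \<noteq> s} = 27"
      unfolding X_def
      by (rule third_layer_repetition[OF a(1) b(1), where w = "?u k" and D = D and y = y])
        (use ij10 two' D a b xy in \<open>auto simp: X_def\<close>)
    with xy show ?thesis by blast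
  qed
  from not_all sum le consider "card ?A = 10" "card ?B = 10" "9 \<le> card ?C"
    | "card ?A = 10" "card ?C = 10" "9 \<le> card ?B" | "card ?B = 10" "card ?C = 10" "9 \<le> card ?A"
    by linarith
  then have "\<exists>k\<in>{1..3}. \<exists>x\<in>D. \<exists>y\<in>D. x \<noteq> y \<and> c (k # x) = c (k # y) \<and> c (k # x) \<noteq> s \<and>
    card {x \<in> X. c (1 # x) \<noteq> s} + card {x \<in> X. c (2 # x) \<noteq> s} + card {x \<in> X. c (3 # x) \<noteq> s} = 27"
  proof cases
    case 1
    show ?thesis by (rule bexI[of _ 3]) (use main[of 1 2 3] 1 two in auto)
  next
    case 2
    show ?thesis by (rule bexI[of _ 2]) (use main[of 1 3 2] 2 two in \<open>fastforce simp: add_ac\<close>)+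
  next
    case 3
    show ?thesis by (rule bexI[of _ 1]) (use main[of 2 3 1] 3 two in \<open>fastforce simp: add_ac\<close>)+
  qed
  then obtain k x y where kxy: "k \<in> {1..3}" "x \<in> D" "y \<in> D" "x \<noteq> y" "c (k # x) = c (k # y)" "c (k # x) \<noteq> s"
    and "card {p \<in> word_cube 3 4. c p \<noteq> s} = 27"
    unfolding Q4 card_filter_word_cube_3_Suc X_def by blast
  moreover obtain i where "i \<in> {1..3}" "x = [i,i,i]" using kxy(2) by (auto simp: D_def)
  moreover obtain j where "j \<in> {1..3}" "y = [j,j,j]" using kxy(3) by (auto simp: D_def)
  ultimately show ?thesis by blast
qed

text \<open>Removing one point of a coinciding pair keeps all colors, so \<open>c\<close> is
  injective on the rest. Every other coincidence therefore involves the removed point; this applies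
  to both \<open>p\<close> and \<open>q\<close>.\<close>

lemma unique_repetition:
  assumes "finite N" "card N \<le> Suc (card (c ` N))"
    and "p \<in> N" "q \<in> N" "p \<noteq> q" "c p = c q"
    and "p' \<in> N" "q' \<in> N" "p' \<noteq> q'" "c p' = c q'"
  shows "{p', q'} = {p, q}"
proof -
  have rem: "inj_on c (N - {t})" if "t \<in> N" "t' \<in> N" "t \<noteq> t'" "c t = c t'" for t t'
  proof (rule eq_card_imp_inj_on)
    have "c ` (N - {t}) = c ` N" using that by auto
    moreover have "card (c ` (N - {t})) \<le> card (N - {t})"
      using assms(1) by (intro card_image_le) auto
    ultimately show "card (c ` (N - {t})) = card (N - {t})"
      using assms(1,2) that(1) by simp
  qed (use assms(1) in auto)
  have "p \<in> {p', q'}" using rem[of p q] assms by (auto dest: inj_onD)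
  moreover have "q \<in> {p', q'}" using rem[of q p] assms by (auto dest: inj_onD)
  ultimately show ?thesis using assms(5) by auto
qed

lemma card_colors_4_le:
  assumes rf: "rainbow_free 4 c"
  shows "card (c ` word_cube 3 4) \<le> 26"
proof (rule ccontr)
  let ?Q = "word_cube 3 4"
  assume "\<not> ?thesis"
  then have r: "27 \<le> card (c ` ?Q)" by simp
  have r': "27 \<le> card ((c \<circ> rev) ` ?Q)"
    using r by (simp only: image_comp[symmetric] rev_word_cube)
  obtain a k i j where a: "card {p \<in> ?Q. c p \<noteq> a} = 27"
    and k: "k \<in> {1..3}" "i \<in> {1..3}" "j \<in> {1..3}" "i \<noteq> j"
      "c [k, i, i, i] = c [k, j, j, j]" "c [k, i, i, i] \<noteq> a"
    using word_cube_4_repetition[OF rf r] by blast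
  obtain a' k' i' j' where a': "card {p \<in> ?Q. (c \<circ> rev) p \<noteq> a'} = 27"
    and k': "k' \<in> {1..3}" "i' \<in> {1..3}" "j' \<in> {1..3}" "i' \<noteq> j'"
      "(c \<circ> rev) [k', i', i', i'] = (c \<circ> rev) [k', j', j', j']" "(c \<circ> rev) [k', i', i', i'] \<noteq> a'"
    using word_cube_4_repetition[OF rainbow_free_rev[OF rf] r'] by blast
  have "{p \<in> ?Q. c p \<noteq> a'} = rev ` {p \<in> ?Q. (c \<circ> rev) p \<noteq> a'}"
  proof -
    have "{p \<in> rev ` ?Q. c p \<noteq> a'} = rev ` {p \<in> ?Q. (c \<circ> rev) p \<noteq> a'}" by auto
    then show ?thesis unfolding rev_word_cube .
  qed
  then have a'27: "card {p \<in> ?Q. c p \<noteq> a'} = 27" using a' by (simp add: card_image)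
  have eq: "a' = a"
  proof (rule ccontr)
    assume "a' \<noteq> a"
    \<comment> \<open>Two sets of 27 points cannot cover 81.\<close>
    then have "?Q \<subseteq> {p \<in> ?Q. c p \<noteq> a} \<union> {p \<in> ?Q. c p \<noteq> a'}" by auto
    then have "card ?Q \<le> card ({p \<in> ?Q. c p \<noteq> a} \<union> {p \<in> ?Q. c p \<noteq> a'})"
      by (intro card_mono) auto
    also have "\<dots> \<le> card {p \<in> ?Q. c p \<noteq> a} + card {p \<in> ?Q. c p \<noteq> a'}" by (rule card_Un_le)
    finally show False using a a'27 by (simp add: card_word_cube)
  qed
  have "{[i', i', i', k'], [j', j', j', k']} = {[k, i, i, i], [k, j, j, j]}"
  proof (rule unique_repetition[of "{p \<in> ?Q. c p \<noteq> a}" c])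
    show "finite {p \<in> ?Q. c p \<noteq> a}" by (rule finite_subset[OF _ finite_word_cube]) blast
    show "card {p \<in> ?Q. c p \<noteq> a} \<le> Suc (card (c ` {p \<in> ?Q. c p \<noteq> a}))"
      using card_image_le_Suc_card_filter[of ?Q c a] a r by simp
  qed (use k k' eq in \<open>auto simp: word_cube_def\<close>)
  \<comment> \<open>The points on the right share their first coordinate \<open>k\<close>, those on
    the left start with \<open>i'\<close> and \<open>j'\<close>.\<close>
  then show False using k'(4) by (auto simp: doubleton_eq_iff)
qed

section \<open>Bounds in all dimensions from 4 on\<close>

text \<open>The bound 26 = 25 + 1 starts the recursion from \<open>b\<close> to
  \<open>3 * b - 2\<close>, which triples the excess over 1.\<close>

lemma card_colors_le:
  "rainbow_free (m + 4) c \<Longrightarrow> card (c ` word_cube 3 (m + 4)) \<le> 25 * 3 ^ m + 1"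
proof (induction m arbitrary: c)
  case 0
  then show ?case using card_colors_4_le by simp
next
  case (Suc m)
  have "card (c ` word_cube 3 (Suc (m + 4))) \<le> 3 * (25 * 3 ^ m + 1) - 2"
    by (rule card_colors_Suc_le) (use Suc in auto)
  then show ?case by simp
qed

lemma ah_le: "ah 3 (m + 4) \<le> 25 * 3 ^ m + 2"
  unfolding ah_def
proof (rule Least_le, intro conjI allI impI)
  fix c :: "nat list \<Rightarrow> nat"
  assume "is_coloring 3 (m + 4) (25 * 3 ^ m + 2) c"
  then have "\<not> rainbow_free (m + 4) c"
    using card_colors_le[of m c] by (auto simp: is_coloring_def)
  then show "\<exists>L\<in>combinatorial_lines 3 (m + 4). rainbow c L" using rainbow_freeI by blast
qed simp

theorem theorem4p9:
  "ah 3 4 \<le> 27 \<and>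
   (\<forall>n::nat. n > 4 \<longrightarrow> int (ah 3 n) \<le> 3 ^ (n - 1) - 2 * 3 ^ (n - 4) + 2)"
proof (intro conjI allI impI)
  show "ah 3 4 \<le> 27" using ah_le[of 0] by simp
next
  fix n :: nat assume "n > 4"
  then obtain m where n: "n = m + 4" by (metis add.commute less_imp_add_positive)
  have "int (ah 3 (m + 4)) \<le> int (25 * 3 ^ m + 2)" using ah_le of_nat_mono by blast
  then show "int (ah 3 n) \<le> 3 ^ (n - 1) - 2 * 3 ^ (n - 4) + 2"
    \<comment> \<open>With \<open>n = m + 4\<close> the bound is (27 - 2) * 3 ^ m + 2.\<close>
    by (simp add: n power_add)
qed

end
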